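(* Let $n\ge3$, let $id=12\cdots n\in\mathcal S_n$ and $v=1\,2\cdots(n-3)\,(n-1)\,(n-2)\,n\in\mathcal S_n$. For $u\in\mathcal S_n$ let $[u]_{sh}$ be its shift equivalence class and $[u]_{ss}$ its super-strong Wilf equivalence class in $\mathcal S_n$. Then $[u]_{sh}=[u]_{ss}$ if $u\sim_{ss}id$ or $u\sim_{ss}v$, and otherwise $[u]_{sh}=[u]_{ss}\sqcup[\tilde u]_{ss}$ (a disjoint union).
   Context: $\tilde u$ denotes the reversal $u_n\cdots u_1$ of $u=u_1\cdots u_n$. Rigid shift: for a word $u=u_1\cdots u_n$ over $\mathbb P$, an integer $h\ge0$ and an integer $t$ such that for every $i$ with $u_i>h$ we have $1\le i+t\le n$ and $u_{i+t}\ge h$, the word $v$ with $v_j=\min(u_j,h)+\max(u_{j-t}-h,0)$ (second term $0$ if $j-t\notin[n]$) is a rigid shift of $u$ (cutting the skyline diagram at height $h$ and rigidly translating the part above the cut by $t$ so that each moved column rests on a column of height $h$). Two words are shift equivalent if one can be obtained from the other by a finite sequence of rigid shifts and reversals. Super-strong Wilf equivalence: for finite words $u,w$ over $\mathbb P$, $j$ is an embedding index of $u$ in $w$ if $j+|u|-1\le|w|$ and $u_k\le w_{j+k-1}$ for all $k$; $Em(u,w)$ is the set of such $j$; $u\sim_{ss}v$ if there is a bijection $f$ of the set of finite words over $\mathbb P$ preserving length and sum of letters with $Em(u,w)=Em(v,f(w))$ for all $w$. *)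

theory Defs
  imports Main
begin

definition pos_word :: "nat list \<Rightarrow> bool" where
  "pos_word w \<longleftrightarrow> (\<forall>x\<in>set w. 0 < x)"

definition pos_words :: "nat list set" where
  "pos_words = {w. pos_word w}"

text \<open>Rigid shift of u at height h by t (0-based positions; same as the 1-based
definition after translating indices).  Natural-number subtraction
implements max(a - h, 0).\<close>

definition rigid_shift :: "nat list \<Rightarrow> nat \<Rightarrow> int \<Rightarrow> nat list \<Rightarrow> bool" where
  "rigid_shift u h t v \<longleftrightarrow>
     length v = length u \<and>
     (\<forall>i<length u. h < u ! i \<longrightarrow>
        0 \<le> int i + t \<and> int i + t < int (length u) \<and> h \<le> u ! nat (int i + t)) \<and>
     (\<forall>j<length u. v ! j = min (u ! j) h +
        (if 0 \<le> int j - t \<and> int j - t < int (length u) then u ! nat (int j - t) - h else 0))"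

definition shift_step :: "nat list \<Rightarrow> nat list \<Rightarrow> bool" where
  "shift_step u v \<longleftrightarrow> (\<exists>h t. rigid_shift u h t v) \<or> v = rev u"

definition shift_equiv :: "nat list \<Rightarrow> nat list \<Rightarrow> bool" where
  "shift_equiv u v \<longleftrightarrow> shift_step\<^sup>*\<^sup>* u v \<or> shift_step\<^sup>*\<^sup>* v u"

text \<open>Embedding indices (1-based, as in the paper).\<close>

definition Em :: "nat list \<Rightarrow> nat list \<Rightarrow> nat set" where
  "Em u w = {j. 1 \<le> j \<and> j + length u - 1 \<le> length w \<and>
               (\<forall>k\<in>{1..length u}. u ! (k - 1) \<le> w ! (j + k - 2))}"

definition ss_equiv :: "nat list \<Rightarrow> nat list \<Rightarrow> bool" where
  "ss_equiv u v \<longleftrightarrow> (\<exists>f. bij_betw f pos_words pos_words \<and>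
      (\<forall>w\<in>pos_words. length (f w) = length w \<and> sum_list (f w) = sum_list w \<and>
                       Em u w = Em v (f w)))"

definition perms :: "nat \<Rightarrow> nat list set" where
  "perms n = {u. length u = n \<and> distinct u \<and> set u = {1..n}}"

definition sh_class :: "nat \<Rightarrow> nat list \<Rightarrow> nat list set" where
  "sh_class n u = {w \<in> perms n. shift_equiv u w}"

definition ss_class :: "nat \<Rightarrow> nat list \<Rightarrow> nat list set" where
  "ss_class n u = {w \<in> perms n. ss_equiv u w}"

definition id_perm :: "nat \<Rightarrow> nat list" where
  "id_perm n = [1..<n+1]"

definition v_perm :: "nat \<Rightarrow> nat list" where
  "v_perm n = [1..<n-2] @ [n-1, n-2, n]"

end

theory Submission
  imports Defs
begin

text \<open>Everything is controlled by the level sets of \<open>u\<close>, the sets of positions of letters \<open>\<ge> h\<close>. Rigid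
  shifts realise exactly the words whose levels are translates of those of \<open>u\<close>; reversal reflects all
  levels at once.

  The least word with embeddings of \<open>u\<close> at all indices in \<open>S\<close> has weight determined by the sum over \<open>h\<close>
  of the cardinalities of \<open>S + level u h\<close>, so by inclusion-exclusion super-strong Wilf equivalence says
  that these sums agree for all \<open>S\<close>. They depend only on the levels up to translation. Conversely, taking
  for \<open>S\<close> a long interval with a reflected copy of \<open>X\<close> removed, they count the translates of levels
  contained in \<open>X\<close>; choosing \<open>X\<close> to be a level of \<open>u\<close>, downward induction on \<open>h\<close> recovers each level up
  to translation.

  Finally a permutation has all levels symmetric only if its levels with at least three elements are
  intervals, which leaves the two exceptional classes.\<close>

text \<open>Positions are integers, so that translations in both directions and reflections are
  total maps.\<close>

definition level :: "nat list \<Rightarrow> nat \<Rightarrow> int set" where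
  "level u h = {i. 0 \<le> i \<and> i < int (length u) \<and> h \<le> u ! nat i}"

text \<open>The translation may depend on the height. This turns out to be reachability by rigid
  shifts alone, without reversals.\<close>

definition level_equiv :: "nat list \<Rightarrow> nat list \<Rightarrow> bool" where
  "level_equiv u v \<longleftrightarrow> length u = length v \<and> (\<forall>h. \<exists>t. level v h = (+) t ` level u h)"

section \<open>Level sets and shift equivalence\<close>

lemma in_image_plus_iff: "x \<in> (+) t ` A \<longleftrightarrow> x - t \<in> A" for x t :: int
  by (metis add_diff_cancel_left' diff_add_cancel add.commute image_iff)

lemma in_image_minus_iff: "x \<in> (-) c ` A \<longleftrightarrow> c - x \<in> A" for x c :: int
  by (auto simp: image_iff intro: bexI[of _ "c - x"])

lemma level_subset: "level u h \<subseteq> {0..<int (length u)}"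
  by (auto simp: level_def)

lemma finite_level [simp]: "finite (level u h)"
  using finite_subset[OF level_subset] by simp

lemma level_0: "level u 0 = {0..<int (length u)}"
  by (auto simp: level_def)

lemma level_antimono: "h \<le> k \<Longrightarrow> level u k \<subseteq> level u h"
  by (auto simp: level_def)

lemma level_empty: "level u h = {}" if "\<forall>x\<in>set u. x < h"
  using that by (auto simp: level_def) (metis nat_less_iff not_le nth_mem)

lemma level_eqD:
  assumes "length u = length v" "\<And>h. level u h = level v h"
  shows "u = v"
proof (rule nth_equalityI)
  fix i assume i: "i < length u"
  have "h \<le> u ! i \<longleftrightarrow> h \<le> v ! i" for h
  proof -
    have "int i \<in> level u h \<longleftrightarrow> int i \<in> level v h"
      using assms(2) by simp
    then show ?thesis
      using i assms(1) by (simp add: level_def)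
  qed
  then show "u ! i = v ! i"
    by (meson order_antisym order_refl)
qed (fact assms(1))

lemma level_rev: "level (rev u) h = (-) (int (length u) - 1) ` level u h"
proof -
  have "x \<in> level (rev u) h \<longleftrightarrow> int (length u) - 1 - x \<in> level u h" for x
  proof (cases "0 \<le> x \<and> x < int (length u)")
    case True
    have "length u - Suc (nat x) = nat (int (length u) - 1 - x)"
      using True by linarith
    with True show ?thesis
      by (auto simp: level_def rev_nth nat_less_iff)
  qed (auto simp: level_def)
  then show ?thesis
    by (intro set_eqI) (simp only: in_image_minus_iff)
qed

lemma level_equiv_refl: "level_equiv u u"
  unfolding level_equiv_def by (metis add_0 image_cong image_ident)

lemma level_equiv_sym: "level_equiv u v \<Longrightarrow> level_equiv v u"
  unfolding level_equiv_def
proof (intro conjI allI; elim conjE)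
  fix h assume "\<forall>h. \<exists>t. level v h = (+) t ` level u h"
  then obtain t where "level v h = (+) t ` level u h" by blast
  then have "level u h = (+) (- t) ` level v h"
    by (simp add: image_image)
  then show "\<exists>t. level u h = (+) t ` level v h" ..
qed simp

lemma level_equiv_trans:
  assumes "level_equiv u v" "level_equiv v w" shows "level_equiv u w"
  unfolding level_equiv_def
proof (intro conjI allI)
  fix h
  obtain s t where "level v h = (+) s ` level u h" "level w h = (+) t ` level v h"
    using assms by (meson level_equiv_def)
  then have "level w h = (+) (t + s) ` level u h"
    by (simp add: image_image add.assoc)
  then show "\<exists>t. level w h = (+) t ` level u h" ..
qed (use assms in \<open>simp add: level_equiv_def\<close>)

lemma level_equiv_rev:
  assumes "level_equiv u v" shows "level_equiv (rev u) (rev v)"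
  unfolding level_equiv_def
proof (intro conjI allI)
  fix h
  have len: "length u = length v"
    using assms by (simp add: level_equiv_def)
  obtain t where "level v h = (+) t ` level u h"
    using assms by (meson level_equiv_def)
  then have "level (rev v) h = (+) (- t) ` level (rev u) h"
    by (simp add: level_rev image_image len algebra_simps)
  then show "\<exists>t. level (rev v) h = (+) t ` level (rev u) h" ..
qed (use assms in \<open>simp add: level_equiv_def\<close>)

text \<open>Each moved piece lands on a column of height at least \<open>h\<close>, which the cut
  trims to exactly \<open>h\<close>. So the heights add up without a gap: nothing changes up to
  \<open>h\<close>, and everything above moves by \<open>t\<close>.\<close>

lemma rigid_shift_level:
  assumes "rigid_shift u h t v"
  shows "level v k = (if k \<le> h then level u k else (+) t ` level u k)"
proof -
  have len: "length v = length u" and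
    fit: "\<And>i. i < length u \<Longrightarrow> h < u ! i \<Longrightarrow>
        0 \<le> int i + t \<and> int i + t < int (length u) \<and> h \<le> u ! nat (int i + t)" and
    val: "\<And>j. j < length u \<Longrightarrow> v ! j = min (u ! j) h +
        (if 0 \<le> int j - t \<and> int j - t < int (length u) then u ! nat (int j - t) - h else 0)"
    using assms by (auto simp: rigid_shift_def)
  have low: "x \<in> level v k \<longleftrightarrow> x \<in> level u k" if "k \<le> h" for x
  proof (cases "0 \<le> x \<and> x < int (length u)")
    case True
    define j where "j = nat x"
    have j: "j < length u" "x = int j" using True by (auto simp: j_def)
    have "k \<le> v ! j \<longleftrightarrow> k \<le> u ! j"
    proof (cases "0 \<le> int j - t \<and> int j - t < int (length u) \<and> h < u ! nat (int j - t)")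
      case True
      then have "h \<le> u ! j"
        using fit[of "nat (int j - t)"] by auto
      then show ?thesis using val[OF j(1)] that by auto
    next
      case False
      then have "v ! j = min (u ! j) h"
        using val[OF j(1)] by auto
      then show ?thesis using that by auto
    qed
    then show ?thesis using j len by (auto simp: level_def)
  qed (auto simp: level_def len)
  have high: "x \<in> level v k \<longleftrightarrow> x - t \<in> level u k" if "h < k" for x
  proof (cases "0 \<le> x - t \<and> x - t < int (length u) \<and> h < u ! nat (x - t)")
    case True
    then have x: "0 \<le> x" "x < int (length u)" "h \<le> u ! nat x"
      using fit[of "nat (x - t)"] by auto
    have "v ! nat x = u ! nat (x - t)"
      using val[of "nat x"] x True by auto
    then show ?thesis using x True by (auto simp: level_def len)
  next
    case False
    then have "v ! nat x \<le> h" if "0 \<le> x" "x < int (length u)"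
      using val[of "nat x"] that by auto
    then show ?thesis using False that by (fastforce simp: level_def len)
  qed
  show ?thesis
    using low high by (auto simp: in_image_plus_iff)
qed

text \<open>The letters above the cut are those in level \<open>Suc h\<close>, so admissibility of
  the cut is precisely this one inclusion.\<close>

lemma rigid_shift_exists:
  assumes "(+) t ` level u (Suc h) \<subseteq> level u h"
  shows "\<exists>v. rigid_shift u h t v"
proof
  define v where "v = map (\<lambda>j. min (u ! j) h +
        (if 0 \<le> int j - t \<and> int j - t < int (length u) then u ! nat (int j - t) - h else 0))
        [0..<length u]"
  have "0 \<le> int i + t \<and> int i + t < int (length u) \<and> h \<le> u ! nat (int i + t)"
    if "i < length u" "h < u ! i" for i
  proof -
    have "int i \<in> level u (Suc h)" using that by (simp add: level_def)
    then have "t + int i \<in> level u h" using assms by auto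
    then show ?thesis by (simp add: level_def add.commute)
  qed
  then show "rigid_shift u h t v"
    by (auto simp: rigid_shift_def v_def)
qed

lemma rigid_shift_level_equiv: "rigid_shift u h t v \<Longrightarrow> level_equiv u v"
  unfolding level_equiv_def
  using rigid_shift_level[of u h t v]
  by (metis add_0 image_cong image_ident rigid_shift_def)

text \<open>Rigid shifts preserve each alternative, and a reversal exchanges the two, since
  \<open>level_equiv\<close> is compatible with \<open>rev\<close>.\<close>

lemma shift_steps_level_equiv:
  "shift_step\<^sup>*\<^sup>* u w \<Longrightarrow> level_equiv u w \<or> level_equiv (rev u) w"
proof (induction rule: rtranclp_induct)
  case base
  show ?case by (simp add: level_equiv_refl)
next
  case (step v w)
  show ?case
    using step(2) unfolding shift_step_def
  proof
    assume "w = rev v"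
    with step.IH show ?case by (metis level_equiv_rev rev_rev_ident)
  next
    assume "\<exists>h t. rigid_shift v h t w"
    with step.IH show ?case by (meson level_equiv_trans rigid_shift_level_equiv)
  qed
qed

text \<open>The levels are brought into position from the bottom up: once all levels up to \<open>h\<close> agree with
  those of the target, level \<open>Suc h\<close> of the target lies inside level \<open>h\<close> of the current word, which
  is precisely what a rigid shift at height \<open>h\<close> needs.\<close>

lemma level_equiv_shift_steps:
  assumes "level_equiv u w"
  shows "shift_step\<^sup>*\<^sup>* u w"
proof -
  have "\<exists>u'. shift_step\<^sup>*\<^sup>* u u' \<and> level_equiv u' w \<and> (\<forall>k\<le>h. level u' k = level w k)" for h
  proof (induction h)
    case 0
    show ?case using assms by (auto simp: level_0 level_equiv_def intro!: exI[of _ u])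
  next
    case (Suc h)
    then obtain u' where u': "shift_step\<^sup>*\<^sup>* u u'" "level_equiv u' w" "\<forall>k\<le>h. level u' k = level w k"
      by blast
    obtain t where t: "level w (Suc h) = (+) t ` level u' (Suc h)"
      using u'(2) by (meson level_equiv_def)
    have "level w (Suc h) \<subseteq> level w h" by (rule level_antimono) simp
    then obtain v where v: "rigid_shift u' h t v"
      using rigid_shift_exists[of t u' h] t u'(3) by auto
    have "shift_step\<^sup>*\<^sup>* u v"
      using u'(1) v by (meson rtranclp.rtrancl_into_rtrancl shift_step_def)
    moreover have "level_equiv v w"
      using rigid_shift_level_equiv[OF v] u'(2) level_equiv_sym level_equiv_trans by blast
    moreover have "\<forall>k\<le>Suc h. level v k = level w k"
      using rigid_shift_level[OF v] u'(3) t by (auto simp: le_Suc_eq)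
    ultimately show ?case by blast
  qed
  \<comment> \<open>The height \<open>sum_list w\<close> bounds every letter of \<open>w\<close>;
    beyond it the levels of \<open>w\<close>, and hence those of \<open>u'\<close>, are
    empty.\<close>
  then obtain u' where u': "shift_step\<^sup>*\<^sup>* u u'" "level_equiv u' w"
      "\<And>k. k \<le> sum_list w \<Longrightarrow> level u' k = level w k"
    by blast
  have "level u' k = level w k" for k
  proof (cases "k \<le> sum_list w")
    case False
    then have "level w k = {}"
      using member_le_sum_list[of _ w] by (intro level_empty) fastforce
    then show ?thesis using u'(2) by (metis level_equiv_def image_is_empty)
  qed (rule u'(3))
  then have "u' = w" using u'(2) level_eqD level_equiv_def by blast
  with u'(1) show ?thesis by simp
qed

lemma shift_equiv_iff: "shift_equiv u w \<longleftrightarrow> level_equiv u w \<or> level_equiv (rev u) w"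
proof
  assume "shift_equiv u w"
  then show "level_equiv u w \<or> level_equiv (rev u) w"
    unfolding shift_equiv_def
    by (metis level_equiv_rev level_equiv_sym rev_rev_ident shift_steps_level_equiv)
next
  have "shift_step u (rev u)" by (simp add: shift_step_def)
  moreover assume "level_equiv u w \<or> level_equiv (rev u) w"
  ultimately show "shift_equiv u w"
    unfolding shift_equiv_def
    by (meson converse_rtranclp_into_rtranclp level_equiv_shift_steps)
qed

section \<open>Super-strong Wilf equivalence as a counting condition\<close>

text \<open>The finite pieces of \<open>pos_words\<close> that a bijection preserving length and sum
  maps to themselves.\<close>

definition words :: "nat \<Rightarrow> nat \<Rightarrow> nat list set" where
  "words N M = {w \<in> pos_words. length w = N \<and> sum_list w = M}"

lemma finite_words: "finite (words N M)"
proof (rule finite_subset)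
  show "words N M \<subseteq> {w. set w \<subseteq> {..M} \<and> length w = N}"
    by (auto simp: words_def dest: member_le_sum_list)
qed (simp add: finite_lists_length_eq)

text \<open>Bijections between corresponding fibres glue together, because the fibres of
  \<open>p\<close> and those of \<open>q\<close> both partition \<open>A\<close>.\<close>

lemma bij_betw_of_equal_fibres:
  assumes fin: "\<And>k. finite {x \<in> A. p x = k}"
    and card: "\<And>k. card {x \<in> A. p x = k} = card {x \<in> A. q x = k}"
    and fin': "\<And>k. finite {x \<in> A. q x = k}"
  shows "\<exists>f. bij_betw f A A \<and> (\<forall>x\<in>A. q (f x) = p x)"
proof -
  have "\<forall>k. \<exists>g. bij_betw g {x \<in> A. p x = k} {x \<in> A. q x = k}"
    using finite_same_card_bij[OF fin fin' card] by blast
  then obtain g where g: "\<And>k. bij_betw (g k) {x \<in> A. p x = k} {x \<in> A. q x = k}"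
    by metis
  define f where "f x = g (p x) x" for x
  have f: "f x \<in> A" "q (f x) = p x" if "x \<in> A" for x
    using bij_betwE[OF g[of "p x"]] that by (auto simp: f_def)
  have "inj_on f A"
  proof (rule inj_onI)
    fix x y assume xy: "x \<in> A" "y \<in> A" "f x = f y"
    then have "p x = p y" using f(2) by metis
    with xy show "x = y"
      using bij_betw_imp_inj_on[OF g[of "p x"]] by (auto simp: f_def inj_on_def)
  qed
  moreover have "f ` A = A"
  proof
    show "A \<subseteq> f ` A"
    proof
      fix y assume "y \<in> A"
      then have "y \<in> g (q y) ` {x \<in> A. p x = q y}"
        using bij_betw_imp_surj_on[OF g[of "q y"]] by auto
      then show "y \<in> f ` A" by (force simp: f_def image_iff)
    qed
  qed (use f in auto)
  ultimately show ?thesis using f by (auto simp: bij_betw_def)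
qed

text \<open>Inclusion-exclusion as an induction from large \<open>S\<close> to small: the count for
  supersets of \<open>S\<close> is the fibre over \<open>S\<close> plus the fibres over strictly
  larger sets, which are already known to agree.\<close>

lemma card_fibres_of_card_superset_fibres:
  fixes p q :: "'a \<Rightarrow> 'b set"
  assumes "finite X" "finite U" and pU: "\<And>x. x \<in> X \<Longrightarrow> p x \<subseteq> U" and qU: "\<And>x. x \<in> X \<Longrightarrow> q x \<subseteq> U"
    and eq: "\<And>S. card {x \<in> X. S \<subseteq> p x} = card {x \<in> X. S \<subseteq> q x}"
  shows "card {x \<in> X. p x = S} = card {x \<in> X. q x = S}"
proof (cases "S \<subseteq> U")
  case True
  have split: "card {x \<in> X. S \<subseteq> r x} = card {x \<in> X. r x = S} + (\<Sum>T | S \<subset> T \<and> T \<subseteq> U. card {x \<in> X. r x = T})"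
    if r: "\<And>x. x \<in> X \<Longrightarrow> r x \<subseteq> U" and "S \<subseteq> U" for S and r :: "'a \<Rightarrow> 'b set"
  proof -
    have "{x \<in> X. S \<subseteq> r x} = {x \<in> X. r x = S} \<union> (\<Union>T\<in>{T. S \<subset> T \<and> T \<subseteq> U}. {x \<in> X. r x = T})"
      using r by auto
    moreover have "card \<dots> = card {x \<in> X. r x = S} + card (\<Union>T\<in>{T. S \<subset> T \<and> T \<subseteq> U}. {x \<in> X. r x = T})"
      by (rule card_Un_disjoint) (auto intro: finite_subset[OF _ \<open>finite X\<close>])
    moreover have "card (\<Union>T\<in>{T. S \<subset> T \<and> T \<subseteq> U}. {x \<in> X. r x = T}) =
        (\<Sum>T | S \<subset> T \<and> T \<subseteq> U. card {x \<in> X. r x = T})"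
      by (rule card_UN_disjoint) (use \<open>finite X\<close> \<open>finite U\<close> in auto)
    ultimately show ?thesis by simp
  qed
  show ?thesis
    using True
  proof (induction "card U - card S" arbitrary: S rule: less_induct)
    case less
    have "card {x \<in> X. p x = T} = card {x \<in> X. q x = T}" if T: "S \<subset> T" "T \<subseteq> U" for T
    proof (rule less.hyps)
      have "card S < card T" "card T \<le> card U"
        using T \<open>finite U\<close> by (meson psubset_card_mono card_mono finite_subset)+
      then show "card U - card T < card U - card S" by simp
    qed (fact T)
    then have "(\<Sum>T | S \<subset> T \<and> T \<subseteq> U. card {x \<in> X. p x = T}) =
        (\<Sum>T | S \<subset> T \<and> T \<subseteq> U. card {x \<in> X. q x = T})"
      by (intro sum.cong) auto
    then show ?case
      using eq[of S] split[OF pU less.prems] split[OF qU less.prems] by simp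
  qed
next
  case False
  then have "{x \<in> X. p x = S} = {}" "{x \<in> X. q x = S} = {}"
    using pU qU by auto
  then show ?thesis by (simp only:)
qed

text \<open>The relation says that length, sum and embedding set are jointly equidistributed for
  \<open>u\<close> and \<open>v\<close>. Superset counts are used because they count the words above
  one least word.\<close>

lemma ss_equiv_iff_card:
  assumes "length u > 0" "length v > 0"
  shows "ss_equiv u v \<longleftrightarrow>
    (\<forall>N M S. card {w \<in> words N M. S \<subseteq> Em u w} = card {w \<in> words N M. S \<subseteq> Em v w})"
proof
  assume "ss_equiv u v"
  then obtain f where f: "bij_betw f pos_words pos_words"
    and ff: "\<And>w. w \<in> pos_words \<Longrightarrow> length (f w) = length w \<and> sum_list (f w) = sum_list w \<and> Em u w = Em v (f w)"
    unfolding ss_equiv_def by blast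
  show "\<forall>N M S. card {w \<in> words N M. S \<subseteq> Em u w} = card {w \<in> words N M. S \<subseteq> Em v w}"
  proof (intro allI)
    fix N M S
    have "card (f ` {w \<in> words N M. S \<subseteq> Em u w}) = card {w \<in> words N M. S \<subseteq> Em u w}"
      using bij_betw_imp_inj_on[OF f]
      by (intro card_image, rule inj_on_subset) (auto simp: words_def)
    moreover have "f ` {w \<in> words N M. S \<subseteq> Em u w} = {w \<in> words N M. S \<subseteq> Em v w}"
    proof
      show "f ` {w \<in> words N M. S \<subseteq> Em u w} \<subseteq> {w \<in> words N M. S \<subseteq> Em v w}"
        using ff bij_betwE[OF f] by (auto simp: words_def)
      show "{w \<in> words N M. S \<subseteq> Em v w} \<subseteq> f ` {w \<in> words N M. S \<subseteq> Em u w}"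
      proof
        fix w assume w: "w \<in> {w \<in> words N M. S \<subseteq> Em v w}"
        then have "w \<in> f ` pos_words"
          using bij_betw_imp_surj_on[OF f] by (simp add: words_def)
        then obtain x where "x \<in> pos_words" "w = f x" by auto
        then show "w \<in> f ` {w \<in> words N M. S \<subseteq> Em u w}"
          using w ff[of x] by (auto simp: words_def)
      qed
    qed
    ultimately show "card {w \<in> words N M. S \<subseteq> Em u w} = card {w \<in> words N M. S \<subseteq> Em v w}"
      by simp
  qed
next
  assume eq: "\<forall>N M S. card {w \<in> words N M. S \<subseteq> Em u w} = card {w \<in> words N M. S \<subseteq> Em v w}"
  \<comment> \<open>This bound supplies the finite universe over which inclusion-exclusion
    runs.\<close>
  have Em_bound: "Em x w \<subseteq> {..N}" if "w \<in> words N M" "length x > 0" for x w N M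
    using that by (cases x) (auto simp: Em_def words_def)
  have fibre: "card {w \<in> words N M. Em u w = S} = card {w \<in> words N M. Em v w = S}" for N M S
    by (rule card_fibres_of_card_superset_fibres[where U = "{..N}"])
      (simp_all only: finite_words finite_atMost Em_bound assms eq)
  \<comment> \<open>Packing the three statistics into one key lets a single glueing produce a
    bijection that respects them all.\<close>
  define key where "key x w = (length w, sum_list w, Em x w)" for x w :: "nat list"
  have key: "{w \<in> pos_words. key x w = k} = {w \<in> words (fst k) (fst (snd k)). Em x w = snd (snd k)}"
    for x k by (auto simp: key_def words_def)
  have "\<exists>f. bij_betw f pos_words pos_words \<and> (\<forall>w\<in>pos_words. key v (f w) = key u w)"
    by (rule bij_betw_of_equal_fibres) (auto simp: key fibre finite_words)
  then show "ss_equiv u v"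
    by (auto simp: ss_equiv_def key_def)
qed

text \<open>Keeping the surpluses \<open>w ! p - m p\<close> and exchanging the lower bound
  \<open>m\<close> for \<open>m'\<close> is injective, and it preserves the sum because both bounds
  have the same total.\<close>

lemma card_words_above_le:
  fixes m m' :: "nat \<Rightarrow> nat"
  assumes "(\<Sum>p<N. m p) = (\<Sum>p<N. m' p)"
  shows "card {w. length w = N \<and> sum_list w = M \<and> (\<forall>p<N. m p \<le> w ! p)}
       \<le> card {w. length w = N \<and> sum_list w = M \<and> (\<forall>p<N. m' p \<le> w ! p)}"
proof (rule card_inj_on_le)
  let ?f = "\<lambda>w. map (\<lambda>p. w ! p - m p + m' p) [0..<N]"
  show "inj_on ?f {w. length w = N \<and> sum_list w = M \<and> (\<forall>p<N. m p \<le> w ! p)}"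
  proof (rule inj_onI)
    fix w w'
    assume w: "w \<in> {w. length w = N \<and> sum_list w = M \<and> (\<forall>p<N. m p \<le> w ! p)}"
      and w': "w' \<in> {w. length w = N \<and> sum_list w = M \<and> (\<forall>p<N. m p \<le> w ! p)}"
      and eq: "?f w = ?f w'"
    show "w = w'"
    proof (rule nth_equalityI)
      fix p assume "p < length w"
      then have p: "p < N" using w by simp
      have "?f w ! p = ?f w' ! p" by (simp only: eq)
      moreover have "m p \<le> w ! p" "m p \<le> w' ! p" using w w' p by auto
      ultimately show "w ! p = w' ! p" using p by simp
    qed (use w w' in simp)
  qed
  have "?f w \<in> {w. length w = N \<and> sum_list w = M \<and> (\<forall>p<N. m' p \<le> w ! p)}"
    if w: "\<forall>p<N. m p \<le> w ! p" and N: "length w = N" "sum_list w = M" for w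
  proof -
    have "(\<Sum>p<N. w ! p - m p + m' p) = (\<Sum>p<N. w ! p - m p) + (\<Sum>p<N. m p)"
      by (simp add: sum.distrib assms)
    also have "\<dots> = (\<Sum>p<N. w ! p)"
      unfolding sum.distrib[symmetric] by (rule sum.cong) (use w N in auto)
    finally have "sum_list (?f w) = sum_list w"
      using N by (simp add: sum_list_sum_nth atLeast0LessThan)
    with N show ?thesis by simp
  qed
  then show "?f ` {w. length w = N \<and> sum_list w = M \<and> (\<forall>p<N. m p \<le> w ! p)}
      \<subseteq> {w. length w = N \<and> sum_list w = M \<and> (\<forall>p<N. m' p \<le> w ! p)}"
    by blast
  show "finite {w. length w = N \<and> sum_list w = M \<and> (\<forall>p<N. m' p \<le> w ! p)}"
  proof (rule finite_subset)
    show "{w. length w = N \<and> sum_list w = M \<and> (\<forall>p<N. m' p \<le> w ! p)} \<subseteq> {w. set w \<subseteq> {..M} \<and> length w = N}"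
      by (auto dest: member_le_sum_list)
  qed (simp add: finite_lists_length_eq)
qed

lemma card_words_above_eq_iff:
  fixes m m' :: "nat \<Rightarrow> nat"
  shows "(\<forall>M. card {w. length w = N \<and> sum_list w = M \<and> (\<forall>p<N. m p \<le> w ! p)}
            = card {w. length w = N \<and> sum_list w = M \<and> (\<forall>p<N. m' p \<le> w ! p)})
         \<longleftrightarrow> (\<Sum>p<N. m p) = (\<Sum>p<N. m' p)" (is "?L \<longleftrightarrow> ?R")
proof
  \<comment> \<open>Take \<open>M\<close> to be the total of \<open>a\<close>: the word
    \<open>a\<close> itself is counted, so some word of the same sum lies above
    \<open>b\<close>.\<close>
  have *: "(\<Sum>p<N. b p) \<le> (\<Sum>p<N. a p)"
    if eq: "\<And>M. card {w. length w = N \<and> sum_list w = M \<and> (\<forall>p<N. a p \<le> w ! p)}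
            = card {w. length w = N \<and> sum_list w = M \<and> (\<forall>p<N. b p \<le> w ! p)}"
    for a b :: "nat \<Rightarrow> nat"
  proof -
    let ?A = "\<lambda>a. {w. length w = N \<and> sum_list w = (\<Sum>p<N. a p) \<and> (\<forall>p<N. a p \<le> w ! p)}"
    let ?B = "{w. length w = N \<and> sum_list w = (\<Sum>p<N. a p) \<and> (\<forall>p<N. b p \<le> w ! p)}"
    have "map a [0..<N] \<in> ?A a"
      by (simp add: sum_list_sum_nth atLeast0LessThan)
    moreover have "finite (?A a)"
      by (rule finite_subset[OF _ finite_lists_length_eq[of "{..\<Sum>p<N. a p}" N]])
        (auto dest: member_le_sum_list)
    ultimately have "card (?A a) > 0" by (auto simp: card_gt_0_iff)
    then have "card ?B > 0" using eq by simp
    then have "?B \<noteq> {}" by fastforce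
    then obtain w where "length w = N" "sum_list w = (\<Sum>p<N. a p)" "\<forall>p<N. b p \<le> w ! p" by blast
    then show ?thesis
      by (metis sum_mono lessThan_iff sum_list_sum_nth atLeast0LessThan)
  qed
  assume ?L
  then show ?R using *[of m m'] *[of m' m] by (simp add: order_antisym)
next
  assume ?R
  then show ?L using card_words_above_le[of m N m'] card_words_above_le[of m' N m] by (simp add: order_antisym)
qed

text \<open>The least positive word having embeddings of \<open>u\<close> at all indices in \<open>S\<close>.\<close>

definition cover :: "nat list \<Rightarrow> nat set \<Rightarrow> nat \<Rightarrow> nat" where
  "cover u S p = Max (insert 1 {u ! i | i. i < length u \<and> (\<exists>j\<in>S. p + 1 = i + j)})"

lemma finite_cover_set: "finite {u ! i | i. i < length u \<and> (\<exists>j\<in>S. p + 1 = i + j)}"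
  by (rule finite_subset[of _ "(!) u ` {..<length u}"]) auto

lemma cover_le_iff: "cover u S p \<le> x \<longleftrightarrow> 1 \<le> x \<and> (\<forall>i<length u. \<forall>j\<in>S. p + 1 = i + j \<longrightarrow> u ! i \<le> x)"
  unfolding cover_def by (subst Max_le_iff) (use finite_cover_set in auto)

lemma le_cover_iff: "h \<le> cover u S p \<longleftrightarrow> h \<le> 1 \<or> (\<exists>i<length u. \<exists>j\<in>S. p + 1 = i + j \<and> h \<le> u ! i)"
  unfolding cover_def by (subst Max_ge_iff) (use finite_cover_set in auto)

section \<open>Minkowski sums of integer sets and the weight of a cover\<close>

definition sumset :: "int set \<Rightarrow> int set \<Rightarrow> int set" where
  "sumset A S = {a + s | a s. a \<in> A \<and> s \<in> S}"

lemma finite_sumset [simp]: "finite A \<Longrightarrow> finite S \<Longrightarrow> finite (sumset A S)"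
  unfolding sumset_def by (rule finite_image_set2) auto

lemma card_image_plus [simp]: "card ((+) t ` A) = card A" for t :: int
  by (rule card_image) simp

lemma sumset_translate_left: "sumset ((+) t ` A) S = (+) t ` sumset A S"
  unfolding sumset_def by (auto simp: add.assoc image_iff) (metis add.assoc)+

lemma sumset_translate_right: "sumset A ((+) t ` S) = (+) t ` sumset A S"
  unfolding sumset_def by (auto simp: image_iff) (metis add.left_commute)+

text \<open>Positions \<open>p\<close> and \<open>i\<close> count from 0 but an embedding index
  \<open>j\<close> counts from 1, whence \<open>p + 1 = i + j\<close> in \<open>cover\<close>. The 1
  inserted there accounts for positivity of the letters.\<close>

lemma words_embedding_iff:
  assumes "length u = n" "0 < n" "S \<subseteq> {1..N + 1 - n}" "n \<le> N"
  shows "{w \<in> words N M. S \<subseteq> Em u w} =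
    {w. length w = N \<and> sum_list w = M \<and> (\<forall>p<N. cover u S p \<le> w ! p)}"
proof -
  have "(w \<in> pos_words \<and> S \<subseteq> Em u w) \<longleftrightarrow> (\<forall>p<N. cover u S p \<le> w ! p)" if w: "length w = N" for w
  proof
    assume l: "w \<in> pos_words \<and> S \<subseteq> Em u w"
    show "\<forall>p<N. cover u S p \<le> w ! p"
      unfolding cover_le_iff
    proof (intro allI impI conjI ballI)
      fix p assume "p < N"
      then show "1 \<le> w ! p"
        using l w by (auto simp: pos_words_def pos_word_def Suc_le_eq)
    next
      fix p i j assume *: "p < N" "i < length u" "j \<in> S" "p + 1 = i + j"
      then have "j \<in> Em u w" using l by auto
      then have "u ! (Suc i - 1) \<le> w ! (j + Suc i - 2)"
        using *(2) unfolding Em_def by (force simp del: diff_Suc_1 diff_Suc_Suc)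
      moreover have "j + Suc i - 2 = p" using *(4) by simp
      ultimately show "u ! i \<le> w ! p" by simp
    qed
  next
    assume r: "\<forall>p<N. cover u S p \<le> w ! p"
    have "w \<in> pos_words"
      using r w by (fastforce simp: pos_words_def pos_word_def cover_le_iff in_set_conv_nth)
    moreover have "S \<subseteq> Em u w"
    proof
      fix j assume j: "j \<in> S"
      then have j': "1 \<le> j" "j \<le> N + 1 - n" using assms(3) by auto
      have "u ! (k - 1) \<le> w ! (j + k - 2)" if "k \<in> {1..length u}" for k
      proof -
        have "j + k - 2 < N" "j + k - 2 + 1 = (k - 1) + j" "k - 1 < length u"
          using that j' assms by auto
        then show ?thesis using r j cover_le_iff by metis
      qed
      then show "j \<in> Em u w"
        using j' assms w by (auto simp: Em_def)
    qed
    ultimately show "w \<in> pos_words \<and> S \<subseteq> Em u w" ..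
  qed
  then show ?thesis by (auto simp: words_def)
qed

text \<open>Each letter of the cover is the number of heights it reaches, so the weight can be
  summed height by height. Height 1 is reached at all \<open>N\<close> positions.\<close>

lemma sum_cover:
  assumes "length u = n" "0 < n" "S \<subseteq> {1..N + 1 - n}" "n \<le> N" "\<forall>x\<in>set u. x \<le> H" "1 \<le> H"
  shows "(\<Sum>p<N. cover u S p) = N + (\<Sum>h=2..H. card (sumset (level u h) (int ` S)))"
proof -
  have cov: "cover u S p = (\<Sum>h=1..H. if h \<le> cover u S p then 1 else 0)" for p
  proof -
    have "cover u S p \<le> H" using assms by (auto simp: cover_le_iff)
    then have "{h \<in> {1..H}. h \<le> cover u S p} = {1..cover u S p}" by auto
    then have "card {h \<in> {1..H}. h \<le> cover u S p} = cover u S p" by simp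
    then show ?thesis
      by (simp add: sum.If_cases Int_def)
  qed
  have "(\<Sum>p<N. cover u S p) = (\<Sum>h=1..H. \<Sum>p<N. if h \<le> cover u S p then 1 else 0)"
    by (subst sum.swap) (rule sum.cong[OF refl], rule cov)
  also have "\<dots> = (\<Sum>h=1..H. card {p \<in> {..<N}. h \<le> cover u S p})"
    by (simp add: sum.If_cases Int_def)
  also have "\<dots> = card {p \<in> {..<N}. 1 \<le> cover u S p} + (\<Sum>h=2..H. card {p \<in> {..<N}. h \<le> cover u S p})"
    using assms(6) by (subst sum.atLeast_Suc_atMost) (auto simp: numeral_2_eq_2)
  also have "{p \<in> {..<N}. 1 \<le> cover u S p} = {..<N}"
    by (auto simp: le_cover_iff)
  also have "(\<Sum>h=2..H. card {p \<in> {..<N}. h \<le> cover u S p}) = (\<Sum>h=2..H. card (sumset (level u h) (int ` S)))"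
  proof (rule sum.cong[OF refl])
    fix h assume h: "h \<in> {2..H}"
    \<comment> \<open>A position counted from 0 plus an index counted from 1 gives
      \<open>p + 1\<close>. Since \<open>h\<close> is at least 2, the default letter 1 of
      \<open>cover\<close> does not reach it.\<close>
    have "(\<lambda>p. int p + 1) ` {p \<in> {..<N}. h \<le> cover u S p} = sumset (level u h) (int ` S)"
    proof (intro equalityI subsetI)
      fix x assume "x \<in> (\<lambda>p. int p + 1) ` {p \<in> {..<N}. h \<le> cover u S p}"
      then obtain p i j where *: "x = int p + 1" "i < length u" "j \<in> S" "p + 1 = i + j" "h \<le> u ! i"
        using h by (auto simp: le_cover_iff)
      then have "x = int i + int j" "int i \<in> level u h" by (auto simp: level_def)
      then show "x \<in> sumset (level u h) (int ` S)" using *(3) by (auto simp: sumset_def)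
    next
      fix x assume "x \<in> sumset (level u h) (int ` S)"
      then obtain a j where *: "a \<in> level u h" "j \<in> S" "x = a + int j"
        by (auto simp: sumset_def)
      define i where "i = nat a"
      have i: "a = int i" "i < length u" "h \<le> u ! i" using *(1) by (auto simp: i_def level_def)
      have j: "1 \<le> j" "j \<le> N + 1 - n" using *(2) assms(3) by auto
      have "i + j - 1 < N" using i j assms by auto
      moreover have "h \<le> cover u S (i + j - 1)"
        unfolding le_cover_iff using i j *(2) by (intro disjI2 exI[of _ i]) auto
      moreover have "x = int (i + j - 1) + 1" using * i j by auto
      ultimately show "x \<in> (\<lambda>p. int p + 1) ` {p \<in> {..<N}. h \<le> cover u S p}" by blast
    qed
    moreover have "inj_on (\<lambda>p. int p + 1) {p \<in> {..<N}. h \<le> cover u S p}" by (auto simp: inj_on_def)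
    ultimately show "card {p \<in> {..<N}. h \<le> cover u S p} = card (sumset (level u h) (int ` S))"
      by (metis card_image)
  qed
  finally show ?thesis by simp
qed

text \<open>Only sets of admissible embedding indices matter for words, but cardinalities of sumsets
  are invariant under translating \<open>S\<close>, so all finite sets of integers may be
  allowed.\<close>

lemma ss_equiv_iff_sumsets:
  assumes u: "length u = n" "\<forall>x\<in>set u. x \<le> H" and v: "length v = n" "\<forall>x\<in>set v. x \<le> H"
    and "0 < n" "1 \<le> H"
  shows "ss_equiv u v \<longleftrightarrow> (\<forall>S. finite S \<longrightarrow>
    (\<Sum>h=2..H. card (sumset (level u h) S)) = (\<Sum>h=2..H. card (sumset (level v h) S)))"
proof -
  have fit: "(\<forall>M. card {w \<in> words N M. S \<subseteq> Em u w} = card {w \<in> words N M. S \<subseteq> Em v w}) \<longleftrightarrow>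
     (\<Sum>h=2..H. card (sumset (level u h) (int ` S))) = (\<Sum>h=2..H. card (sumset (level v h) (int ` S)))"
    if "S \<subseteq> {1..N + 1 - n}" "n \<le> N" for N S
    using card_words_above_eq_iff[of N "cover u S" "cover v S"] that assms
    by (simp add: words_embedding_iff sum_cover)
  show ?thesis
  proof
    assume "ss_equiv u v"
    then have eq: "card {w \<in> words N M. S \<subseteq> Em u w} = card {w \<in> words N M. S \<subseteq> Em v w}" for N M S
      using ss_equiv_iff_card assms by simp
    show "\<forall>S. finite S \<longrightarrow>
      (\<Sum>h=2..H. card (sumset (level u h) S)) = (\<Sum>h=2..H. card (sumset (level v h) S))"
    proof (intro allI impI)
      fix S :: "int set" assume "finite S"
      then obtain k where k: "\<forall>s\<in>S. \<bar>s\<bar> \<le> k" 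
        by (metis finite_imageI image_eqI Max_ge)
      \<comment> \<open>With all elements of \<open>S\<close> of absolute value at most
        \<open>k\<close>, adding \<open>\<bar>k\<bar> + 1\<close> moves \<open>S\<close> to positive
        indices; \<open>N\<close> is then chosen long enough to admit them.\<close>
      define T where "T = nat ` (+) (\<bar>k\<bar> + 1) ` S"
      have iT: "int ` T = (+) (\<bar>k\<bar> + 1) ` S"
        using k unfolding T_def by (force simp: image_image intro!: image_cong)
      define N where "N = nat (2 * \<bar>k\<bar> + 1) + n"
      have "T \<subseteq> {1..N + 1 - n}"
        using k by (fastforce simp: T_def N_def)
      then have "(\<Sum>h=2..H. card (sumset (level u h) (int ` T))) = (\<Sum>h=2..H. card (sumset (level v h) (int ` T)))"
        using fit[of T N] eq by (simp add: N_def)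
      then show "(\<Sum>h=2..H. card (sumset (level u h) S)) = (\<Sum>h=2..H. card (sumset (level v h) S))"
        by (simp add: iT sumset_translate_right)
    qed
  next
    assume r: "\<forall>S. finite S \<longrightarrow>
      (\<Sum>h=2..H. card (sumset (level u h) S)) = (\<Sum>h=2..H. card (sumset (level v h) S))"
    have "card {w \<in> words N M. S \<subseteq> Em u w} = card {w \<in> words N M. S \<subseteq> Em v w}" for N M S
    proof (cases "S = {} \<or> S \<subseteq> {1..N + 1 - n} \<and> n \<le> N")
      case True
      then show ?thesis
      proof
        assume *: "S \<subseteq> {1..N + 1 - n} \<and> n \<le> N"
        then have "finite S" using finite_subset by blast
        then show ?thesis using fit[of S N] * r by simp
      qed simp
    next
      \<comment> \<open>Now \<open>S\<close> is nonempty and cannot be a set of embedding indices in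
        a word of length \<open>N\<close>, so both counts are 0.\<close>
      case False
      have "\<not> S \<subseteq> Em x w" if "w \<in> words N M" "length x = n" for x w
      proof
        assume "S \<subseteq> Em x w"
        then have "S \<subseteq> {1..N + 1 - n}" "S \<noteq> {} \<Longrightarrow> n \<le> N"
          using that \<open>0 < n\<close> by (fastforce simp: Em_def words_def)+
        then show False using False by blast
      qed
      then have "{w \<in> words N M. S \<subseteq> Em u w} = {}" "{w \<in> words N M. S \<subseteq> Em v w} = {}"
        using u v by auto
      then show ?thesis by (simp only:)
    qed
    then show "ss_equiv u v" using ss_equiv_iff_card[of u v] assms by simp
  qed
qed

section \<open>Recovering the levels\<close>

definition fits :: "int set \<Rightarrow> int set \<Rightarrow> int set" where
  "fits A X = {t. (+) t ` A \<subseteq> X}"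

lemma finite_fits:
  assumes "finite X" "A \<noteq> {}" shows "finite (fits A X)"
proof -
  obtain a where a: "a \<in> A" using assms by blast
  have "fits A X \<subseteq> (\<lambda>x. x - a) ` X"
  proof
    fix t assume "t \<in> fits A X"
    then have "t + a \<in> X" using a by (auto simp: fits_def)
    then show "t \<in> (\<lambda>x. x - a) ` X" by (metis add_diff_cancel_right' image_eqI)
  qed
  then show ?thesis using assms finite_subset by blast
qed

lemma card_fits_translate: "card (fits ((+) s ` A) X) = card (fits A X)"
proof -
  have "fits ((+) s ` A) X = (\<lambda>t. t - s) ` fits A X"
  proof (intro equalityI subsetI)
    fix t assume "t \<in> fits ((+) s ` A) X"
    then have "t + s \<in> fits A X" by (auto simp: fits_def add.assoc)
    then show "t \<in> (\<lambda>t. t - s) ` fits A X" by (metis add_diff_cancel_right' image_eqI)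
  qed (auto simp: fits_def)
  then show ?thesis by (simp add: card_image inj_on_def)
qed

text \<open>Removing \<open>-X\<close> from a long interval removes from the sumset just the points \<open>-t\<close>, where
  \<open>t + A \<subseteq> X\<close>.\<close>

lemma card_sumset_add_card_fits:
  assumes "A \<subseteq> {0..<m}" "X \<subseteq> {0..<m}" "A \<noteq> {}"
  shows "card (sumset A ({-2*m..2*m} - uminus ` X)) + card (fits A X) = card (sumset A {-2*m..2*m})"
proof -
  let ?S = "{-2*m..2*m} - uminus ` X"
  have finA: "finite A" using assms finite_subset by blast
  have finX: "finite X" using assms finite_subset by blast
  have dis: "sumset A ?S \<inter> uminus ` fits A X = {}"
  proof (rule ccontr)
    assume "sumset A ?S \<inter> uminus ` fits A X \<noteq> {}"
    then obtain x where x: "x \<in> sumset A ?S" "x \<in> uminus ` fits A X" by blast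
    then obtain t where "t \<in> fits A X" "x = - t" by blast
    moreover obtain a s where "a \<in> A" "s \<in> ?S" "x = a + s"
      using x(1) unfolding sumset_def by blast
    ultimately have *: "a \<in> A" "s \<in> ?S" "t \<in> fits A X" "a + s = - t" by simp_all
    then have "t + a \<in> X" by (auto simp: fits_def)
    moreover have "s = - (t + a)" using * by simp
    ultimately show False using *(2) by blast
  qed
  have un: "sumset A {-2*m..2*m} = sumset A ?S \<union> uminus ` fits A X"
  proof (intro equalityI subsetI)
    fix x assume "x \<in> sumset A {-2*m..2*m}"
    then obtain a s where as: "a \<in> A" "s \<in> {-2*m..2*m}" "x = a + s" by (auto simp: sumset_def)
    show "x \<in> sumset A ?S \<union> uminus ` fits A X"
    proof (rule ccontr)
      assume no: "x \<notin> sumset A ?S \<union> uminus ` fits A X"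
      have nS: "x - b \<notin> ?S" if "b \<in> A" for b
        using no that unfolding sumset_def by (auto simp del: Diff_iff)
      then have "s \<in> uminus ` X" using as by force
      then have sX: "- s \<in> X" by auto
      have "- x + b \<in> X" if b: "b \<in> A" for b
      proof -
        have "0 \<le> a" "a < m" "0 \<le> b" "b < m" "0 \<le> - s" "- s < m"
          using as b sX assms by auto
        then have "x - b \<in> {-2*m..2*m}" using as by auto
        with nS[OF b] obtain y where "y \<in> X" "x - b = - y" by blast
        moreover from this have "- x + b = y" by simp
        ultimately show ?thesis by simp
      qed
      then have "- x \<in> fits A X" by (auto simp: fits_def)
      then show False using no by (metis UnI2 image_eqI minus_minus)
    qed
  next
    fix x assume "x \<in> sumset A ?S \<union> uminus ` fits A X"
    then show "x \<in> sumset A {-2*m..2*m}"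
    proof
      assume "x \<in> uminus ` fits A X"
      then obtain t where t: "x = - t" "(+) t ` A \<subseteq> X" by (auto simp: fits_def)
      obtain a where a: "a \<in> A" using assms by blast
      have "t + a \<in> {0..<m}" using t a assms by blast
      then have "x - a \<in> {-2*m..2*m}" using t by auto
      moreover have "x = a + (x - a)" by simp
      ultimately show ?thesis unfolding sumset_def using a by blast
    qed (auto simp: sumset_def)
  qed
  have "card (sumset A {-2*m..2*m}) = card (sumset A ?S) + card (uminus ` fits A X)"
    unfolding un by (rule card_Un_disjoint) (use dis finA finX finite_fits assms in auto)
  then show ?thesis by (simp add: card_image)
qed

section \<open>Level sets of permutations\<close>

lemma perms_pos: "u \<in> perms n \<Longrightarrow> x \<in> set u \<Longrightarrow> 1 \<le> x \<and> x \<le> n"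
  by (auto simp: perms_def)

text \<open>Each value occurs at exactly one position. The \<open>max 1 h\<close> takes care of
  \<open>h = 0\<close>, since the letters start at 1.\<close>

lemma card_level:
  assumes "u \<in> perms n" shows "card (level u h) = card {max 1 h..n}"
proof -
  have u: "length u = n" "distinct u" "set u = {1..n}" using assms by (auto simp: perms_def)
  have "bij_betw (\<lambda>i. u ! nat i) (level u h) {max 1 h..n}"
    unfolding bij_betw_def
  proof
    show "inj_on (\<lambda>i. u ! nat i) (level u h)"
      using u by (auto simp: inj_on_def level_def nth_eq_iff_index_eq)
    show "(\<lambda>i. u ! nat i) ` level u h = {max 1 h..n}"
    proof
      show "(\<lambda>i. u ! nat i) ` level u h \<subseteq> {max 1 h..n}"
      proof
        fix y assume "y \<in> (\<lambda>i. u ! nat i) ` level u h"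
        then obtain i where i: "0 \<le> i" "i < int (length u)" "h \<le> u ! nat i" "y = u ! nat i"
          by (auto simp: level_def)
        then have "y \<in> set u" by (auto simp: nat_less_iff)
        then show "y \<in> {max 1 h..n}" using i u by auto
      qed
      show "{max 1 h..n} \<subseteq> (\<lambda>i. u ! nat i) ` level u h"
      proof
        fix x assume x: "x \<in> {max 1 h..n}"
        then have "x \<in> set u" using u by auto
        then obtain i where "i < length u" "u ! i = x" by (auto simp: in_set_conv_nth)
        then have "int i \<in> level u h" "x = u ! nat (int i)" using x by (auto simp: level_def)
        then show "x \<in> (\<lambda>i. u ! nat i) ` level u h" by blast
      qed
    qed
  qed
  then show ?thesis by (rule bij_betw_same_card)
qed

lemma level_1: "u \<in> perms n \<Longrightarrow> level u (Suc 0) = {0..<int n}"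
  by (rule card_subset_eq) (use card_level[of u n "Suc 0"] level_subset[of u] in \<open>auto simp: perms_def\<close>)

text \<open>The remaining heights are automatic: levels 0 and 1 are the whole range of positions,
  level \<open>n\<close> is a single point, and higher levels are empty.\<close>

lemma level_equiv_permsI:
  assumes u: "u \<in> perms n" and v: "v \<in> perms n"
    and mid: "\<And>h. 2 \<le> h \<Longrightarrow> h < n \<Longrightarrow> \<exists>t. level v h = (+) t ` level u h"
  shows "level_equiv u v"
  unfolding level_equiv_def
proof (intro conjI allI)
  have len: "length u = n" "length v = n" using u v by (auto simp: perms_def)
  then show "length u = length v" by simp
  fix h
  consider "h = 0" | "h = Suc 0" | "2 \<le> h" "h < n" | "1 \<le> h" "h = n" | "n < h" by linarith
  then show "\<exists>t. level v h = (+) t ` level u h"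
  proof cases
    case 1
    then show ?thesis by (intro exI[of _ 0]) (simp add: level_0 len)
  next
    case 2
    then show ?thesis by (intro exI[of _ 0]) (simp add: level_1[OF u] level_1[OF v])
  next
    case 4
    then have "card (level u h) = 1" "card (level v h) = 1"
      using card_level[OF u] card_level[OF v] by simp_all
    then obtain a b where "level u h = {a}" "level v h = {b}"
      by (auto simp: card_1_singleton_iff)
    then show ?thesis by (intro exI[of _ "b - a"]) simp
  next
    case 5
    then have "level u h = {}" "level v h = {}"
      using perms_pos[OF u] perms_pos[OF v] by (auto intro!: level_empty dest: le_less_trans)
    then show ?thesis by simp
  qed (rule mid)
qed

lemma ss_equiv_iff_level_equiv:
  assumes u: "u \<in> perms n" and v: "v \<in> perms n" and "0 < n"
  shows "ss_equiv u v \<longleftrightarrow> level_equiv u v"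
proof -
  have len: "length u = n" "length v = n" using u v by (auto simp: perms_def)
  have iff: "ss_equiv u v \<longleftrightarrow> (\<forall>S. finite S \<longrightarrow>
    (\<Sum>h=2..n. card (sumset (level u h) S)) = (\<Sum>h=2..n. card (sumset (level v h) S)))"
    by (rule ss_equiv_iff_sumsets) (use assms perms_pos len in auto)
  show ?thesis
  proof
    assume "level_equiv u v"
    then have "card (sumset (level u h) S) = card (sumset (level v h) S)" for h S
      by (metis level_equiv_def sumset_translate_left card_image_plus)
    then show "ss_equiv u v" unfolding iff by simp
  next
    assume "ss_equiv u v"
    then have eq: "(\<Sum>h=2..n. card (sumset (level u h) S)) = (\<Sum>h=2..n. card (sumset (level v h) S))"
      if "finite S" for S using iff that by blast
    have ne: "level w h \<noteq> {}" if "w \<in> perms n" "h \<in> {2..n}" for w h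
      using card_level[OF that(1), of h] that by fastforce
    have fits: "(\<Sum>h=2..n. card (fits (level u h) X)) = (\<Sum>h=2..n. card (fits (level v h) X))"
      if X: "X \<subseteq> {0..<int n}" for X
    proof -
      let ?I = "{-2 * int n..2 * int n}"
      have *: "(\<Sum>h=2..n. card (sumset (level w h) (?I - uminus ` X))) + (\<Sum>h=2..n. card (fits (level w h) X))
          = (\<Sum>h=2..n. card (sumset (level w h) ?I))" if "w \<in> perms n" for w
        unfolding sum.distrib[symmetric]
        by (rule sum.cong[OF refl], rule card_sumset_add_card_fits)
          (use that X ne level_subset[of w] in \<open>auto simp: perms_def\<close>)
      show ?thesis
        using *[OF u] *[OF v] eq[of ?I] eq[of "?I - uminus ` X"] by simp
    qed
    have "\<exists>t. level v h = (+) t ` level u h" if "h \<in> {2..n}" for h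
      using that
    proof (induction "n - h" arbitrary: h rule: less_induct)
      case less
      let ?X = "level u h"
      have X: "?X \<subseteq> {0..<int n}" using level_subset[of u h] len by simp
      have up: "card (fits (level u k) ?X) = card (fits (level v k) ?X)" if "k \<in> {h<..n}" for k
      proof -
        have "\<exists>t. level v k = (+) t ` level u k"
          using less.hyps[of k] that less.prems by auto
        then show ?thesis by (metis card_fits_translate)
      qed
      have I: "{2..n} = {2..h} \<union> {h<..n}" using less.prems by auto
      have "(\<Sum>k=2..n. f k) = (\<Sum>k=2..h. f k) + (\<Sum>k\<in>{h<..n}. f k)" for f :: "nat \<Rightarrow> nat"
        unfolding I by (rule sum.union_disjoint) auto
      then have low: "(\<Sum>k=2..h. card (fits (level u k) ?X)) = (\<Sum>k=2..h. card (fits (level v k) ?X))"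
        using fits[OF X] up by simp
      \<comment> \<open>Heights above \<open>h\<close> cancel by induction, and the zero translation
        makes the remaining sum for \<open>u\<close> positive; hence some level
        \<open>k \<le> h\<close> of \<open>v\<close> fits into \<open>?X\<close>.\<close>
      have "0 \<in> fits (level u h) ?X" by (auto simp: fits_def)
      then have "card (fits (level u h) ?X) \<noteq> 0"
        using finite_fits[of ?X "level u h"] ne[OF u less.prems] by auto
      then have "(\<Sum>k=2..h. card (fits (level u k) ?X)) \<noteq> 0"
        using less.prems by auto
      then obtain k where k: "k \<in> {2..h}" "card (fits (level v k) ?X) \<noteq> 0"
        using low by (metis (no_types, lifting) sum.neutral)
      then have "fits (level v k) ?X \<noteq> {}" by fastforce
      then obtain t where t: "(+) t ` level v k \<subseteq> level u h" by (auto simp: fits_def)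
      \<comment> \<open>Lower levels of a permutation are strictly larger, so fitting forces
        \<open>k = h\<close>, and equal cardinality turns the inclusion into equality.\<close>
      then have "card (level v k) \<le> card (level u h)"
        using card_mono[OF finite_level t] by simp
      then have kh: "k = h"
        using k less.prems card_level[OF v, of k] card_level[OF u, of h] by auto
      have "(+) t ` level v h = level u h"
        using t unfolding kh by (intro card_subset_eq) (use card_level u v in auto)
      then have "(+) (- t) ` level u h = level v h"
        by (simp add: image_image flip: \<open>(+) t ` level v h = level u h\<close>)
      then show ?case by metis
    qed
    then show "level_equiv u v"
      using level_equiv_permsI[OF u v] by auto
  qed
qed

section \<open>Reversal-invariant classes\<close>

lemma level_Suc:
  assumes "u \<in> perms n" "1 \<le> h" "h \<le> n"
  shows "\<exists>x\<in>level u h. level u (Suc h) = level u h - {x}"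
proof -
  have sub: "level u (Suc h) \<subseteq> level u h" by (rule level_antimono) simp
  have "card (level u h - level u (Suc h)) = 1"
    using assms card_level[of u n] by (simp add: card_Diff_subset sub)
  then obtain x where "level u h - level u (Suc h) = {x}" by (auto simp: card_1_singleton_iff)
  then show ?thesis using sub by (intro bexI[of _ x]) auto
qed

text \<open>Reversal is a reflection, and composing it with the translation back gives a reflection
  that preserves the level. Its centre may vary with \<open>h\<close>.\<close>

lemma level_symmetric:
  assumes "level_equiv u (rev u)"
  shows "\<exists>c. \<forall>z. z \<in> level u h \<longleftrightarrow> c - z \<in> level u h"
proof -
  obtain t where t: "level (rev u) h = (+) t ` level u h"
    using assms by (meson level_equiv_def)
  have "z \<in> level u h \<longleftrightarrow> int (length u) - 1 - t - z \<in> level u h" for z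
  proof -
    have "z + t \<in> level (rev u) h \<longleftrightarrow> z \<in> level u h"
      unfolding t in_image_plus_iff by simp
    moreover have "z + t \<in> level (rev u) h \<longleftrightarrow> int (length u) - 1 - (z + t) \<in> level u h"
      unfolding level_rev in_image_minus_iff ..
    ultimately show ?thesis by (simp add: algebra_simps)
  qed
  then show ?thesis by blast
qed

lemma level_equiv_revI:
  assumes "\<And>h. \<exists>c. \<forall>z. z \<in> level u h \<longleftrightarrow> c - z \<in> level u h"
  shows "level_equiv u (rev u)"
  unfolding level_equiv_def
proof (intro conjI allI)
  fix h
  obtain c where c: "\<And>z. z \<in> level u h \<longleftrightarrow> c - z \<in> level u h" using assms by blast
  have "level (rev u) h = (+) (int (length u) - 1 - c) ` level u h"
    unfolding set_eq_iff level_rev in_image_minus_iff in_image_plus_iff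
  proof
    fix z
    show "int (length u) - 1 - z \<in> level u h \<longleftrightarrow> z - (int (length u) - 1 - c) \<in> level u h"
      using c[of "int (length u) - 1 - z"] by (simp add: algebra_simps)
  qed
  then show "\<exists>t. level (rev u) h = (+) t ` level u h" ..
qed simp

text \<open>If both endpoints survive, they force \<open>c = 2 * a + m\<close>; this reflection
  preserves the interval and so must fix the deleted point.\<close>

lemma symmetric_interval_minus_point:
  fixes a m x c :: int
  assumes "a \<le> x" "x \<le> a + m"
    and sym: "\<And>z. z \<in> {a..a+m} - {x} \<longleftrightarrow> c - z \<in> {a..a+m} - {x}"
  shows "x = a \<or> x = a + m \<or> 2 * x = 2 * a + m"
  using assms(1,2) sym[of a] sym[of "a + m"] sym[of x] by auto

text \<open>If \<open>y\<close> is an endpoint, the extreme remaining points move the centre by one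
  half, so a surviving neighbour of \<open>x\<close> is reflected to \<open>x\<close>. Otherwise the
  centre stays at \<open>x\<close>, and the mirror image of \<open>y\<close> survives although
  \<open>y\<close> does not. The bound on \<open>m\<close> leaves two points on each side of
  \<open>x\<close>.\<close>

lemma not_symmetric_interval_minus_middle:
  fixes a m x y d :: int
  assumes "4 \<le> m" "2 * x = 2 * a + m" "a \<le> y" "y \<le> a + m" "y \<noteq> x"
    and sym: "\<And>z. z \<in> {a..a+m} - {x} - {y} \<longleftrightarrow> d - z \<in> {a..a+m} - {x} - {y}"
  shows False
proof -
  have refl: "a \<le> d - z \<and> d - z \<le> a + m \<and> d - z \<noteq> x \<and> d - z \<noteq> y"
    if "a \<le> z" "z \<le> a + m" "z \<noteq> x" "z \<noteq> y" for z
    using iffD1[OF sym, of z] that by simp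
  have x: "a + 2 \<le> x" "x + 2 \<le> a + m" using assms(1,2) by auto
  consider "y = a" | "y = a + m" | "y \<noteq> a" "y \<noteq> a + m" by blast
  then show False
  proof cases
    case 1
    have "d - (a + 1) \<le> a + m" using refl[of "a + 1"] x 1 by simp
    moreover have "a \<le> d - (a + m)" "d - (a + m) \<noteq> y" using refl[of "a + m"] x 1 by simp_all
    ultimately have "d - (x + 1) = x" using 1 assms(2) by linarith
    then show False using refl[of "x + 1"] x 1 by simp
  next
    case 2
    have "a \<le> d - (a + m - 1)" using refl[of "a + m - 1"] x 2 by simp
    moreover have "d - a \<le> a + m" "d - a \<noteq> y" using refl[of a] x 2 by simp_all
    ultimately have "d - (x - 1) = x" using 2 assms(2) by linarith
    then show False using refl[of "x - 1"] x 2 by simp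
  next
    case 3
    have "d - a \<le> a + m" using refl[of a] x 3 by simp
    moreover have "a \<le> d - (a + m)" using refl[of "a + m"] x 3 by simp
    ultimately have d: "d = 2 * a + m" by linarith
    have "d - y \<noteq> x" "d - y \<noteq> y" using assms(2,5) d by linarith+
    moreover have "a \<le> d - y" "d - y \<le> a + m" using d assms(3,4) by linarith+
    ultimately show False using refl[of "d - y"] by simp
  qed
qed

text \<open>Deleting the middle of an interval keeps it symmetric, but no further point can be deleted
  symmetrically, unless at most two points remain.\<close>

lemma symmetric_levels_are_intervals:
  assumes u: "u \<in> perms n" and "level_equiv u (rev u)" and "1 \<le> h" "h + 2 \<le> n"
  shows "\<exists>a. level u h = {a..a + (int n - int h)}"
  using assms(3,4)
proof (induction h rule: dec_induct)
  case base
  have "{0..<int n} = {0..0 + (int n - int 1)}" by auto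
  then have "level u 1 = {0..0 + (int n - int 1)}" using level_1[OF u] by simp
  then show ?case ..
next
  case (step h)
  define m where "m = int n - int h"
  have "h + 2 \<le> n" using step.prems by simp
  from step.IH[OF this] obtain a where a: "level u h = {a..a+m}" unfolding m_def ..
  obtain x where x: "x \<in> {a..a+m}" "level u (Suc h) = {a..a+m} - {x}"
    using level_Suc[OF u, of h] step a by auto
  obtain c where c: "\<And>z. z \<in> {a..a+m} - {x} \<longleftrightarrow> c - z \<in> {a..a+m} - {x}"
    using level_symmetric[OF assms(2), of "Suc h"] unfolding x(2) by blast
  have "a \<le> x" "x \<le> a + m" using x(1) by auto
  from symmetric_interval_minus_point[OF this c]
  consider "x = a" | "x = a + m" | "2 * x = 2 * a + m" by blast
  then show ?case
  proof cases
    case 1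
    have "{a..a+m} - {a} = {a + 1..(a + 1) + (m - 1)}" by auto
    with 1 have "level u (Suc h) = {a + 1..(a + 1) + (int n - int (Suc h))}"
      by (simp add: x(2) m_def)
    then show ?thesis ..
  next
    case 2
    have "{a..a+m} - {a + m} = {a..a + (m - 1)}" by auto
    with 2 have "level u (Suc h) = {a..a + (int n - int (Suc h))}"
      by (simp add: x(2) m_def)
    then show ?thesis ..
  next
    case 3
    \<comment> \<open>The premise gives \<open>m \<ge> 3\<close>, and \<open>m\<close> is even
      because the interval has a middle point.\<close>
    then have "4 \<le> m" using step.prems m_def by presburger
    obtain y where y: "y \<in> {a..a+m} - {x}" "level u (Suc (Suc h)) = {a..a+m} - {x} - {y}"
    proof -
      have "1 \<le> Suc h" "Suc h \<le> n" using step.prems by simp_all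
      from level_Suc[OF u this] that show thesis unfolding x(2) by blast
    qed
    obtain d where d: "\<And>z. z \<in> {a..a+m} - {x} - {y} \<longleftrightarrow> d - z \<in> {a..a+m} - {x} - {y}"
      using level_symmetric[OF assms(2), of "Suc (Suc h)"] unfolding y(2) by blast
    have "a \<le> y" "y \<le> a + m" "y \<noteq> x" using y(1) by auto
    from not_symmetric_interval_minus_middle[OF \<open>4 \<le> m\<close> 3 this d]
    show ?thesis ..
  qed
qed

section \<open>The two exceptional permutations\<close>

lemma id_perm_in_perms: "id_perm n \<in> perms n"
  by (auto simp: id_perm_def perms_def)

lemma v_perm_in_perms: "3 \<le> n \<Longrightarrow> v_perm n \<in> perms n"
  by (auto simp: v_perm_def perms_def)

lemma level_id_perm: "1 \<le> h \<Longrightarrow> level (id_perm n) h = {int h - 1..<int n}"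
  by (auto simp: level_def id_perm_def simp del: upt_Suc)

lemma nth_v_perm:
  assumes "3 \<le> n" "i < n"
  shows "v_perm n ! i = (if i = n - 3 then n - 1 else if i = n - 2 then n - 2 else i + 1)"
proof -
  consider "i < n - 3" | "i = n - 3" | "i = n - 2" | "i = n - 1" using assms by linarith
  then show ?thesis
    using assms by cases (auto simp: v_perm_def nth_append nth_Cons' simp del: upt_Suc)
qed

lemma length_v_perm: "3 \<le> n \<Longrightarrow> length (v_perm n) = n"
  by (simp add: v_perm_def)

text \<open>Compared with the identity only the letters \<open>n - 2\<close> and
  \<open>n - 1\<close> are exchanged, and only the level at \<open>n - 1\<close> separates
  them.\<close>

lemma level_v_perm:
  assumes "3 \<le> n" "1 \<le> h" "h \<le> n"
  shows "level (v_perm n) h = (if h = n - 1 then {int n - 3, int n - 1} else {int h - 1..<int n})"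
proof -
  have "x \<in> level (v_perm n) h \<longleftrightarrow>
      x \<in> (if h = n - 1 then {int n - 3, int n - 1} else {int h - 1..<int n})" for x
  proof (cases "0 \<le> x \<and> x < int n")
    case True
    then obtain i where i: "x = int i" "i < n" by (metis nonneg_int_cases of_nat_less_iff)
    then have *: "x \<in> level (v_perm n) h \<longleftrightarrow> h \<le> v_perm n ! i"
      by (simp add: level_def length_v_perm assms(1))
    consider "i = n - 3" | "i = n - 2" | "i \<noteq> n - 3" "i \<noteq> n - 2" by blast
    then show ?thesis
      unfolding * unfolding nth_v_perm[OF assms(1) i(2)] using assms i by cases auto
  qed (use assms in \<open>auto simp: level_def length_v_perm\<close>)
  then show ?thesis by blast
qed

lemma intervals_translate: "\<exists>t. {b..b + m} = (+) t ` {a..a + m}" for a b m :: int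
  by (rule exI[of _ "b - a"]) simp

text \<open>Symmetry makes all levels up to \<open>n - 2\<close> intervals, so the only choice left
  is where the letter \<open>n - 2\<close> sits among the three positions of that level: in the
  middle for \<open>v_perm\<close>, at an end for \<open>id_perm\<close>.\<close>

lemma symmetric_class:
  assumes u: "u \<in> perms n" and "3 \<le> n"
  shows "level_equiv u (rev u) \<longleftrightarrow> level_equiv u (id_perm n) \<or> level_equiv u (v_perm n)"
proof
  assume sym: "level_equiv u (rev u)"
  have low: "\<exists>t. {int h - 1..<int n} = (+) t ` level u h" if h: "1 \<le> h" "h \<le> n - 2" for h
  proof -
    have "h + 2 \<le> n" using h assms(2) by simp
    obtain a where "level u h = {a..a + (int n - int h)}"
      using symmetric_levels_are_intervals[OF u sym h(1) \<open>h + 2 \<le> n\<close>] by blast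
    moreover have "{int h - 1..<int n} = {int h - 1..(int h - 1) + (int n - int h)}" by auto
    ultimately show ?thesis using intervals_translate by metis
  qed
  have "1 \<le> n - 2" "n - 2 + 2 \<le> n" using assms(2) by simp_all
  from symmetric_levels_are_intervals[OF u sym this]
  obtain a where "level u (n - 2) = {a..a + (int n - int (n - 2))}" ..
  moreover have "int n - int (n - 2) = 2" using assms(2) by simp
  moreover have "{a..a + 2} = {a, a + 1, a + 2}" by auto
  ultimately have a: "level u (n - 2) = {a, a + 1, a + 2}" by simp
  obtain x where x: "x \<in> {a, a + 1, a + 2}" "level u (n - 1) = {a, a + 1, a + 2} - {x}"
  proof -
    have n: "Suc (n - 2) = n - 1" "1 \<le> n - 2" "n - 2 \<le> n" using assms(2) by simp_all
    from level_Suc[OF u n(2,3)] that show thesis unfolding n(1) a by blast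
  qed
  show "level_equiv u (id_perm n) \<or> level_equiv u (v_perm n)"
  proof (cases "x = a + 1")
    case True
    have "level_equiv u (v_perm n)"
    proof (rule level_equiv_permsI[OF u v_perm_in_perms[OF assms(2)]])
      fix h assume h: "2 \<le> h" "h < n"
      show "\<exists>t. level (v_perm n) h = (+) t ` level u h"
      proof (cases "h = n - 1")
        case True
        have "{a, a + 1, a + 2} - {a + 1} = {a, a + 2}" by auto
        with \<open>x = a + 1\<close> have "level u (n - 1) = {a, a + 2}" by (simp only: x(2))
        then have "level (v_perm n) h = (+) (int n - 3 - a) ` level u h"
          using True assms(2) by (simp add: level_v_perm)
        then show ?thesis ..
      qed (use low h assms(2) in \<open>simp add: level_v_perm\<close>)
    qed
    then show ?thesis ..
  next
    case False
    have "level_equiv u (id_perm n)"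
    proof (rule level_equiv_permsI[OF u id_perm_in_perms])
      fix h assume h: "2 \<le> h" "h < n"
      show "\<exists>t. level (id_perm n) h = (+) t ` level u h"
      proof (cases "h = n - 1")
        case True
        obtain b where "level u (n - 1) = {b..b + 1}"
        proof -
          have "{a, a + 1, a + 2} - {a} = {a + 1..(a + 1) + 1}"
            "{a, a + 1, a + 2} - {a + 2} = {a..a + 1}" by auto
          moreover have "x = a \<or> x = a + 2" using x(1) False by blast
          ultimately show thesis using that x(2) by metis
        qed
        moreover have "level (id_perm n) h = {int n - 2..(int n - 2) + 1}"
        proof -
          have "int (n - 1) - 1 = int n - 2" "1 \<le> n - 1" using assms(2) by simp_all
          moreover have "{int n - 2..<int n} = {int n - 2..(int n - 2) + 1}" by auto
          ultimately show ?thesis using True by (simp only: level_id_perm)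
        qed
        ultimately show ?thesis unfolding True by (simp only: intervals_translate)
      qed (use low h in \<open>simp add: level_id_perm\<close>)
    qed
    then show ?thesis ..
  qed
next
  have sym: "\<exists>c. \<forall>z. z \<in> level w h \<longleftrightarrow> c - z \<in> level w h"
    if w: "w \<in> {id_perm n, v_perm n}" for w h
  proof -
    have wp: "w \<in> perms n" using w assms(2) id_perm_in_perms v_perm_in_perms by auto
    consider "h = 0" | "1 \<le> h" "h \<le> n" | "n < h" by linarith
    then show ?thesis
    proof cases
      case 1
      show ?thesis unfolding 1 level_0 by (rule exI[of _ "int (length w) - 1"]) auto
    next
      case 2
      \<comment> \<open>In both cases the reflection constant is the sum of the two extreme
        points.\<close>
      then have "level w h = {int h - 1..<int n} \<or> level w h = {int n - 3, int n - 1}"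
        using w level_id_perm[OF 2(1)] level_v_perm[OF assms(2) 2] by (metis insertE singletonD)
      then show ?thesis
      proof
        assume *: "level w h = {int h - 1..<int n}"
        show ?thesis unfolding * by (rule exI[of _ "int h + int n - 2"]) auto
      next
        assume *: "level w h = {int n - 3, int n - 1}"
        show ?thesis unfolding * by (rule exI[of _ "2 * int n - 4"]) auto
      qed
    next
      case 3
      then have "level w h = {}" using perms_pos[OF wp] by (intro level_empty) fastforce
      then show ?thesis by simp
    qed
  qed
  assume "level_equiv u (id_perm n) \<or> level_equiv u (v_perm n)"
  then obtain w where w: "w \<in> {id_perm n, v_perm n}" "level_equiv u w" by blast
  have "level_equiv w (rev w)" using level_equiv_revI sym[OF w(1)] by blast
  then show "level_equiv u (rev u)"
    using w(2) by (meson level_equiv_rev level_equiv_sym level_equiv_trans)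
qed

theorem mainTheorem13:
  fixes n :: nat and u :: "nat list"
  assumes "3 \<le> n" and "u \<in> perms n"
  shows "(ss_equiv u (id_perm n) \<or> ss_equiv u (v_perm n) \<longrightarrow> sh_class n u = ss_class n u) \<and>
         (\<not> (ss_equiv u (id_perm n) \<or> ss_equiv u (v_perm n)) \<longrightarrow>
            sh_class n u = ss_class n u \<union> ss_class n (rev u) \<and>
            ss_class n u \<inter> ss_class n (rev u) = {})"
proof -
  have rev: "rev u \<in> perms n" using assms(2) by (simp add: perms_def)
  have "0 < n" using assms(1) by simp
  note ss = ss_equiv_iff_level_equiv[OF _ _ \<open>0 < n\<close>]
  have sh_class: "sh_class n u = {w \<in> perms n. level_equiv u w \<or> level_equiv (rev u) w}"
    by (simp add: sh_class_def shift_equiv_iff)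
  have ss_class: "ss_class n w = {x \<in> perms n. level_equiv w x}" if "w \<in> perms n" for w
    using ss[OF that] by (auto simp: ss_class_def)
  \<comment> \<open>The exceptional case is that of a class invariant under reversal, where the
    classes of \<open>u\<close> and \<open>rev u\<close> coincide; otherwise they are distinct
    classes of an equivalence relation, hence disjoint.\<close>
  have cond: "ss_equiv u (id_perm n) \<or> ss_equiv u (v_perm n) \<longleftrightarrow> level_equiv u (rev u)"
    using assms ss id_perm_in_perms v_perm_in_perms symmetric_class by simp
  show ?thesis
    unfolding cond sh_class ss_class[OF assms(2)] ss_class[OF rev]
    using level_equiv_trans level_equiv_sym by blast
qed

end
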